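(* Let $r \geq 2$, $k \geq 2$ and $n \geq f(r,k)$ be integers. If $G$ is a connected $r$-graph such that $|V(G)| = n$ and $\Delta(G) = k$, then \[\alpha(G) \leq n - \left\lceil \frac{n-1}{k(r-1)} \right\rceil = \left\lfloor \frac{(k(r-1)-1)n + 1}{k(r-1)} \right\rfloor,\] and equality holds if $G = U_{n,r,k}$ (that is, $\alpha(U_{n,r,k}) = n - \left\lceil \frac{n-1}{k(r-1)} \right\rceil$).
   Context: All sets are finite unless evidently infinite; $\mathbb{N}=\{1,2,\dots\}$; for integers $1\le m \leq n$, $[m,n] = \{i \in \mathbb{N} : m \leq i \leq n\}$ and $[n]=[1,n]$; $[0]=\emptyset$. For a set $X$, $\binom{X}{r}$ is the set of all $r$-element subsets of $X$. An $r$-graph $G$ is a pair $(V(G),E(G))$ where $V(G)$ is a set (of vertices) and $E(G) \subseteq \binom{V(G)}{r}$ (the edges). A set $I \subseteq V(G)$ is independent if no edge of $G$ is a subset of $I$; $\alpha(G)$ is the size of a largest independent set of $G$. The degree $d_G(v)$ of a vertex $v$ is the number of edges containing $v$; $\Delta(G) = \max\{d_G(v) : v \in V(G)\}$. A $vw$-path of $G$ is a sequence $e_1,\dots,e_p$ of edges ($p \geq 1$) with $v \in e_1$, $w \in e_p$, and $e_i \cap e_{i+1} \neq \emptyset$ for each $i \in [p-1]$. $G$ is connected if it has a $vw$-path for every two distinct vertices $v,w$. For $r \geq 2$ and $k \geq 1$, $f(r,k)$ is the smallest integer $n$ such that there exists an $r$-graph $G$ with $\Delta(G)=k$ and $|V(G)|=n$.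 Construction of $U_{n,r,k}$ (for $r \geq 2$, $k \geq 2$, $n \geq f(r,k)$). Let $p = \left\lceil \frac{n-1}{k(r-1)} \right\rceil$, so $p \geq 1$ and $n-1 = (p-1)k(r-1)+q$ for some integer $q$ with $1 \leq q \leq k(r-1)$. Let $n' = n-p$, so $n' = (p-1)(k(r-1)-1)+q$. For each $(i,j,h) \in \mathbb{N} \times [k] \times [r-1]$, let \[x_{i,j,h} = (i-1)(k(r-1)-1) + (j-1)(r-1) + h.\] For each $i \in [p]$, let $y_i = n'+i$. For each $(i,j) \in [p]\times[k]$, let $X_{i,j} = \{x_{i,j,h} : h \in [r-1]\}$ and $Y_{i,j} = X_{i,j} \cup \{y_i\}$. Write $q = s(r-1)+t$ with $s \in \{0\}\cup[k]$ and $t \in \{0\} \cup [r-2]$ (where $s<k$ if $t>0$, and $s>0$ if $t=0$). Let $X'_{p,s+1} = [n'-r+2, n']$ and $Y'_{p,s+1} = X'_{p,s+1} \cup \{y_p\}$. Let \[M_{n,r,k} = \{Y_{i,j} : (i,j) \in ([p-1]\times[k]) \cup (\{p\}\times[s])\} \cup \{Y'_{p,s+1}\}.\] If $n > k(r-1)+1$, then $U_{n,r,k} = ([n], M_{n,r,k})$. If $n \leq k(r-1)+1$ (so $p=1$ and $y_1=n$), choose a set $S_{n,r,k}$ with $M_{n,r,k} \subseteq S_{n,r,k} \subseteq \{A \in \binom{[n]}{r} : n \in A\}$ and $|S_{n,r,k}| = k$ (possible because $n \geq f(r,k)$; any fixed choice), and let $U_{n,r,k} = ([n], S_{n,r,k})$.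 *)

theory Defs
  imports Complex_Main "HOL-Library.Ramsey"
begin

type_synonym 'a hypergraph = "'a set \<times> 'a set set"

abbreviation verts :: "'a hypergraph \<Rightarrow> 'a set" where "verts G \<equiv> fst G"
abbreviation edges :: "'a hypergraph \<Rightarrow> 'a set set" where "edges G \<equiv> snd G"

text \<open>The library's \<^term>\<open>nsets X r\<close> is the set of all \<open>r\<close>-element subsets of \<open>X\<close>.
  All vertex sets are finite.\<close>

definition r_graph :: "nat \<Rightarrow> 'a hypergraph \<Rightarrow> bool" where
  "r_graph r G \<longleftrightarrow> finite (verts G) \<and> edges G \<subseteq> nsets (verts G) r"

definition independent :: "'a hypergraph \<Rightarrow> 'a set \<Rightarrow> bool" where
  "independent G I \<longleftrightarrow> I \<subseteq> verts G \<and> (\<forall>e\<in>edges G. \<not> e \<subseteq> I)"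

definition independence_number :: "'a hypergraph \<Rightarrow> nat" where
  "independence_number G = Max (card ` {I. independent G I})"

definition hdegree :: "'a hypergraph \<Rightarrow> 'a \<Rightarrow> nat" where
  "hdegree G v = card {e \<in> edges G. v \<in> e}"

text \<open>Inserting \<open>0\<close> only matters for the graph with no vertices, where the maximum would
  otherwise be over the empty set and hence unspecified.\<close>

definition max_degree :: "'a hypergraph \<Rightarrow> nat" where
  "max_degree G = Max (insert 0 (hdegree G ` verts G))"

definition hpath :: "'a hypergraph \<Rightarrow> 'a \<Rightarrow> 'a \<Rightarrow> 'a set list \<Rightarrow> bool" where
  "hpath G v w es \<longleftrightarrow> es \<noteq> [] \<and> set es \<subseteq> edges G \<and> v \<in> hd es \<and> w \<in> last es \<and>
     (\<forall>i. Suc i < length es \<longrightarrow> es ! i \<inter> es ! Suc i \<noteq> {})"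

definition hconnected :: "'a hypergraph \<Rightarrow> bool" where
  "hconnected G \<longleftrightarrow> (\<forall>v\<in>verts G. \<forall>w\<in>verts G. v \<noteq> w \<longrightarrow> (\<exists>es. hpath G v w es))"

text \<open>The number \<open>f(r,k)\<close>. Every finite graph is isomorphic to one whose vertices are natural
  numbers, so fixing the vertex type loses nothing.\<close>

definition min_order :: "nat \<Rightarrow> nat \<Rightarrow> nat" where
  "min_order r k = (LEAST n. \<exists>G :: nat hypergraph.
     r_graph r G \<and> max_degree G = k \<and> card (verts G) = n)"


text \<open>The ingredients of the construction \<open>U\<^bsub>n,r,k\<^esub>\<close>, for \<open>r \<ge> 2\<close>, \<open>k \<ge> 2\<close> and
  \<open>n \<ge> f(r,k)\<close>. In this range none of the subtractions below is truncated.\<close>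

definition U_p :: "nat \<Rightarrow> nat \<Rightarrow> nat \<Rightarrow> nat" where
  "U_p n r k = nat \<lceil>real (n - 1) / real (k * (r - 1))\<rceil>"

definition U_q :: "nat \<Rightarrow> nat \<Rightarrow> nat \<Rightarrow> nat" where
  "U_q n r k = (n - 1) - (U_p n r k - 1) * (k * (r - 1))"

definition U_n' :: "nat \<Rightarrow> nat \<Rightarrow> nat \<Rightarrow> nat" where
  "U_n' n r k = n - U_p n r k"

text \<open>The quotient in \<open>q = s(r-1)+t\<close> with \<open>0 \<le> t \<le> r-2\<close>; the remainder \<open>t\<close> is not needed.\<close>

definition U_s :: "nat \<Rightarrow> nat \<Rightarrow> nat \<Rightarrow> nat" where
  "U_s n r k = U_q n r k div (r - 1)"

definition U_x :: "nat \<Rightarrow> nat \<Rightarrow> nat \<Rightarrow> nat \<Rightarrow> nat \<Rightarrow> nat" where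
  "U_x r k i j h = (i - 1) * (k * (r - 1) - 1) + (j - 1) * (r - 1) + h"

definition U_y :: "nat \<Rightarrow> nat \<Rightarrow> nat \<Rightarrow> nat \<Rightarrow> nat" where
  "U_y n r k i = U_n' n r k + i"

definition U_X :: "nat \<Rightarrow> nat \<Rightarrow> nat \<Rightarrow> nat \<Rightarrow> nat set" where
  "U_X r k i j = {U_x r k i j h | h. h \<in> {1..r - 1}}"

definition U_Y :: "nat \<Rightarrow> nat \<Rightarrow> nat \<Rightarrow> nat \<Rightarrow> nat \<Rightarrow> nat set" where
  "U_Y n r k i j = U_X r k i j \<union> {U_y n r k i}"

text \<open>The sets \<open>X'\<^bsub>p,s+1\<^esub> = [n'-r+2, n']\<close> and \<open>Y'\<^bsub>p,s+1\<^esub>\<close>. As \<open>n' = r-1\<close> is possible, the lower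
  end is written with the addition first.\<close>

definition U_X' :: "nat \<Rightarrow> nat \<Rightarrow> nat \<Rightarrow> nat set" where
  "U_X' n r k = {U_n' n r k + 2 - r..U_n' n r k}"

definition U_Y' :: "nat \<Rightarrow> nat \<Rightarrow> nat \<Rightarrow> nat set" where
  "U_Y' n r k = U_X' n r k \<union> {U_y n r k (U_p n r k)}"

definition U_M :: "nat \<Rightarrow> nat \<Rightarrow> nat \<Rightarrow> nat set set" where
  "U_M n r k =
     {U_Y n r k i j | i j. (i, j) \<in> {1..U_p n r k - 1} \<times> {1..k} \<union> {U_p n r k} \<times> {1..U_s n r k}}
     \<union> {U_Y' n r k}"

definition U_choice :: "nat \<Rightarrow> nat \<Rightarrow> nat \<Rightarrow> nat set set \<Rightarrow> bool" where
  "U_choice n r k S \<longleftrightarrow>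
     U_M n r k \<subseteq> S \<and> S \<subseteq> {A \<in> nsets {1..n} r. n \<in> A} \<and> card S = k"

text \<open>\<open>is_U n r k G\<close> says that \<open>G\<close> is a graph \<open>U\<^bsub>n,r,k\<^esub>\<close>. For \<open>n \<le> k(r-1)+1\<close> the
  construction leaves open which edge set is chosen, so it is a predicate rather than a function;
  the lemma at the end of this theory shows that a choice always exists.\<close>

definition is_U :: "nat \<Rightarrow> nat \<Rightarrow> nat \<Rightarrow> nat hypergraph \<Rightarrow> bool" where
  "is_U n r k G \<longleftrightarrow>
     (if n > k * (r - 1) + 1 then G = ({1..n}, U_M n r k)
      else \<exists>S. U_choice n r k S \<and> G = ({1..n}, S))"

lemma card_star_le_max_degree:
  "finite (verts G) \<Longrightarrow> v \<in> verts G \<Longrightarrow> hdegree G v \<le> max_degree G"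
  unfolding max_degree_def by (rule Max_ge) auto

lemma min_order_attained:
  assumes "r \<ge> 2" "k \<ge> 1"
  obtains G :: "nat hypergraph"
  where "r_graph r G" "max_degree G = k" "card (verts G) = min_order r k"
proof -
  define e where "e = (\<lambda>i. insert (r - 1 + i) {..<r - 1})"
  define G :: "nat hypergraph" where "G = ({..<r + k}, e ` {..<k})"
  have inj: "inj_on e {..<k}"
  proof (rule inj_onI)
    fix i j assume "e i = e j"
    then have "r - 1 + i \<in> insert (r - 1 + j) {..<r - 1}" unfolding e_def by blast
    then show "i = j" by auto
  qed
  have cE: "card (e ` {..<k}) = k" using inj by (simp add: card_image)
  have rg: "r_graph r G"
    using assms by (auto simp: r_graph_def G_def nsets_def e_def)
  have d0: "hdegree G 0 = k"
  proof -
    have "{A \<in> edges G. 0 \<in> A} = e ` {..<k}" using assms by (auto simp: G_def e_def)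
    then show ?thesis using cE by (simp add: hdegree_def)
  qed
  have dle: "hdegree G v \<le> k" for v
  proof -
    have "card {A \<in> edges G. v \<in> A} \<le> card (e ` {..<k})"
      by (rule card_mono) (auto simp: G_def)
    then show ?thesis using cE by (simp add: hdegree_def)
  qed
  have "max_degree G = k"
    unfolding max_degree_def
  proof (rule Max_eqI)
    show "finite (insert 0 (hdegree G ` verts G))" by (simp add: G_def)
    show "k \<in> insert 0 (hdegree G ` verts G)"
      using d0 assms by (auto simp: G_def intro!: image_eqI[where x = 0])
  qed (use dle in auto)
  with rg have "\<exists>G :: nat hypergraph. r_graph r G \<and> max_degree G = k \<and> card (verts G) = card (verts G)"
    by blast
  then have "\<exists>n. \<exists>G :: nat hypergraph. r_graph r G \<and> max_degree G = k \<and> card (verts G) = n"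
    by blast
  then have "\<exists>G :: nat hypergraph. r_graph r G \<and> max_degree G = k \<and> card (verts G) = min_order r k"
    unfolding min_order_def by (rule LeastI_ex)
  then show ?thesis using that by blast
qed

lemma min_order_star:
  assumes "r \<ge> 2" "k \<ge> 1" "n \<ge> min_order r k"
  shows "k \<le> card {A \<in> nsets {1..n} r. n \<in> A}" "r \<le> n"
proof -
  obtain G :: "nat hypergraph"
    where G: "r_graph r G" "max_degree G = k" "card (verts G) = min_order r k"
    using min_order_attained assms(1,2) by blast
  let ?V = "verts G"
  have fin: "finite ?V" using G(1) by (simp add: r_graph_def)
  have "k \<in> insert 0 (hdegree G ` ?V)"
    using fin Max_in[of "insert 0 (hdegree G ` ?V)"] G(2) by (simp add: max_degree_def)
  then obtain v where v: "v \<in> ?V" "hdegree G v = k" using assms(2) by auto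
  let ?St = "{e \<in> edges G. v \<in> e}"
  have cs: "card ?St = k" using v by (simp add: hdegree_def)
  have St: "A \<subseteq> ?V \<and> finite A \<and> card A = r" if "A \<in> ?St" for A
    using that G(1) by (auto simp: r_graph_def nsets_def)
  have "?St \<noteq> {}" using cs assms(2) by (metis card.empty not_one_le_zero)
  then obtain A where "A \<in> ?St" by blast
  with St[of A] fin have "r \<le> card ?V" by (metis card_mono)
  then show rn: "r \<le> n" using G(3) assms(3) by simp
  have "card (?V - {v}) \<le> card {1..n - 1}" using fin v(1) G(3) assms(3) by simp
  then obtain g where g: "g ` (?V - {v}) \<subseteq> {1..n - 1}" "inj_on g (?V - {v})"
    using card_le_inj[of "?V - {v}" "{1..n - 1}"] fin by auto
  define h where "h = g(v := n)"
  have hv: "h v = n" by (simp add: h_def)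
  have n0: "n \<ge> 1" using rn assms(1) by simp
  have hr: "h ` ?V \<subseteq> {1..n}"
  proof
    fix y assume "y \<in> h ` ?V"
    then obtain x where x: "x \<in> ?V" "y = h x" by blast
    show "y \<in> {1..n}"
    proof (cases "x = v")
      case True
      then show ?thesis using x n0 hv by simp
    next
      case False
      then have "g x \<in> {1..n - 1}" using g(1) x by blast
      then show ?thesis using x False by (auto simp: h_def)
    qed
  qed
  have hne: "h x \<noteq> n" if "x \<in> ?V" "x \<noteq> v" for x
  proof -
    have "g x \<in> {1..n - 1}" using g(1) that by blast
    then show ?thesis using that n0 by (auto simp: h_def)
  qed
  have hi: "inj_on h ?V"
  proof (rule inj_onI)
    fix x y assume xy: "x \<in> ?V" "y \<in> ?V" "h x = h y"
    show "x = y"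
    proof (cases "x = v \<or> y = v")
      case True then show ?thesis using xy hne hv by metis
    next
      case False then show ?thesis using xy g(2) by (auto simp: h_def inj_on_def)
    qed
  qed
  have "inj_on (image h) ?St"
    using inj_on_image_Pow[OF hi] St by (auto intro: inj_on_subset)
  moreover have "image h ` ?St \<subseteq> {A \<in> nsets {1..n} r. n \<in> A}"
  proof
    fix B assume "B \<in> image h ` ?St"
    then obtain A where A: "A \<in> ?St" "B = h ` A" by blast
    have "card B = r" using A St[OF A(1)] hi by (metis card_image inj_on_subset)
    moreover have "B \<subseteq> {1..n}" using A(2) St[OF A(1)] hr by blast
    moreover have "n \<in> B" using A hv by force
    ultimately show "B \<in> {A \<in> nsets {1..n} r. n \<in> A}"
      using St[OF A(1)] A(2) by (simp add: nsets_def)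
  qed
  moreover have "finite {A \<in> nsets {1..n} r. n \<in> A}"
    by (simp add: finite_imp_finite_nsets)
  ultimately have "card ?St \<le> card {A \<in> nsets {1..n} r. n \<in> A}"
    by (rule card_inj_on_le)
  then show "k \<le> card {A \<in> nsets {1..n} r. n \<in> A}" using cs by simp
qed

lemma is_U_exists:
  assumes r: "r \<ge> 2" and k: "k \<ge> 2" and n: "n \<ge> min_order r k"
  shows "\<exists>G. is_U n r k G"
proof (cases "n > k * (r - 1) + 1")
  case True
  then show ?thesis by (simp add: is_U_def)
next
  case False
  let ?T = "{A \<in> nsets {1..n} r. n \<in> A}"
  have T: "k \<le> card ?T" and rn: "r \<le> n"
    using min_order_star[of r k n] r k n by auto
  have finT: "finite ?T" by (simp add: finite_imp_finite_nsets)
  have D: "k * (r - 1) > 0" using r k by simp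
  have "real (n - 1) / real (k * (r - 1)) \<le> 1"
  proof -
    have "n - 1 \<le> k * (r - 1)" using False by linarith
    then have "real (n - 1) \<le> real (k * (r - 1))" by (simp only: of_nat_le_iff)
    moreover have "0 < real (k * (r - 1))" using D by (simp only: of_nat_0_less_iff)
    ultimately show ?thesis by (simp only: divide_le_eq_1_pos)
  qed
  moreover have "real (n - 1) / real (k * (r - 1)) > 0"
  proof (rule divide_pos_pos)
    have "n - 1 > 0" using rn r by linarith
    then show "real (n - 1) > 0" by (simp only: of_nat_0_less_iff)
    show "real (k * (r - 1)) > 0" using D by (simp only: of_nat_0_less_iff)
  qed
  ultimately have "\<lceil>real (n - 1) / real (k * (r - 1))\<rceil> = 1" by (simp only: ceiling_eq_iff) simp
  then have p: "U_p n r k = 1" by (simp only: U_p_def)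
  have q: "U_q n r k = n - 1" and n': "U_n' n r k = n - 1" by (simp_all add: U_q_def U_n'_def p)
  have y: "U_y n r k 1 = n" using n' rn r by (simp add: U_y_def)
  define s where "s = U_s n r k"
  have s: "s = (n - 1) div (r - 1)" by (simp add: s_def U_s_def q)
  have sle: "s * (r - 1) \<le> n - 1" unfolding s by simp
  have M: "U_M n r k = (\<lambda>j. U_Y n r k 1 j) ` {1..s} \<union> {U_Y' n r k}"
    by (auto simp: U_M_def p s_def)
  have X: "U_X r k 1 j = {(j - 1) * (r - 1) + 1..(j - 1) * (r - 1) + (r - 1)}" for j
  proof -
    have "U_X r k 1 j = (\<lambda>h. (j - 1) * (r - 1) + h) ` {1..r - 1}"
      unfolding U_X_def U_x_def image_def by (rule Collect_cong) auto
    then show ?thesis by (simp only: image_add_atLeastAtMost) (simp only: add.commute)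
  qed
  have Yp: "U_Y' n r k = {n + 1 - r..n - 1} \<union> {n}"
    using rn r by (simp add: U_Y'_def U_X'_def p y n' del: One_nat_def) (simp add: Suc_diff_le)
  have "U_Y n r k 1 j \<in> ?T" if j: "j \<in> {1..s}" for j
  proof -
    have "(j - 1) * (r - 1) + (r - 1) = j * (r - 1)"
      using j by (cases j) auto
    also have "\<dots> \<le> s * (r - 1)" using j by (intro mult_right_mono) auto
    finally have le: "(j - 1) * (r - 1) + (r - 1) \<le> n - 1" using sle by simp
    define a where "a = (j - 1) * (r - 1)"
    have le': "a + (r - 1) < n" using le rn r unfolding a_def by linarith
    have Y: "U_Y n r k 1 j = insert n {a + 1..a + (r - 1)}"
      unfolding U_Y_def X y a_def by simp
    have "n \<notin> {a + 1..a + (r - 1)}" using le' by simp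
    then have "card (U_Y n r k 1 j) = r" unfolding Y using r by simp
    moreover have "U_Y n r k 1 j \<subseteq> {1..n}" unfolding Y using le' by auto
    ultimately show ?thesis unfolding nsets_def Y by simp
  qed
  moreover have "U_Y' n r k \<in> ?T"
  proof -
    have "n \<notin> {n + 1 - r..n - 1}" using rn r by auto
    then have "card (insert n {n + 1 - r..n - 1}) = r"
      using rn r by (subst card_insert_disjoint) auto
    moreover have "insert n {n + 1 - r..n - 1} \<subseteq> {1..n}" using rn r by auto
    ultimately show ?thesis unfolding Yp nsets_def by simp
  qed
  ultimately have MT: "U_M n r k \<subseteq> ?T" unfolding M by blast
  have cI: "card ((\<lambda>j. U_Y n r k 1 j) ` {1..s}) \<le> s"
    by (metis card_image_le card_atLeastAtMost diff_Suc_1 finite_atLeastAtMost)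
  have sk: "s \<le> k"
  proof -
    have "s * (r - 1) \<le> k * (r - 1)" using sle False by linarith
    then show ?thesis using r by simp
  qed
  have cM: "card (U_M n r k) \<le> k"
  proof (cases "s < k")
    case True
    have "card (U_M n r k) \<le> Suc (card ((\<lambda>j. U_Y n r k 1 j) ` {1..s}))"
      unfolding M by (simp add: card_insert_le_m1 card_insert_if)
    then show ?thesis using cI True by linarith
  next
    case False': False
    then have sk': "s = k" using sk by simp
    then have nk: "n - 1 = k * (r - 1)" using sle[unfolded sk'] False by linarith
    have "(k - 1) * (r - 1) + (r - 1) = n - 1" unfolding nk using k by (cases k) auto
    then have a: "(k - 1) * (r - 1) + 1 = n + 1 - r" "(k - 1) * (r - 1) + (r - 1) = n - 1"
      using rn r by linarith+
    have "U_Y n r k 1 k = U_Y' n r k" unfolding U_Y_def X y Yp a by simp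
    then have "U_M n r k = (\<lambda>j. U_Y n r k 1 j) ` {1..s}"
      unfolding M using sk' k by auto
    then show ?thesis using cI sk by simp
  qed
  obtain S where "U_M n r k \<subseteq> S" "S \<subseteq> ?T" "card S = k"
    using exists_subset_between[OF cM T MT finT] by blast
  then have "U_choice n r k S" by (simp add: U_choice_def)
  then show ?thesis using False by (auto simp: is_U_def)
qed

end

theory Submission
  imports Defs "HOL-Library.Disjoint_Sets"
begin

text \<open>
  Let \<open>D = k(r-1)\<close>.

  \<^emph>\<open>Upper bound.\<close> The complement \<open>C\<close> of an independent set meets every edge, and each vertex of
  \<open>C\<close> lies in at most \<open>k\<close> edges, so there are at most \<open>k|C|\<close> edges. On the other hand, a connected
  \<open>r\<close>-graph can be built up from a single vertex by adding edges one at a time, each of which meets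
  what is already there and so contributes at most \<open>r-1\<close> new vertices; hence \<open>n-1\<close> is at most
  \<open>r-1\<close> times the number of edges. Together, \<open>n-1 \<le> D|C|\<close>, that is, \<open>|C| \<ge> \<lceil>(n-1)/D\<rceil>\<close>.

  \<^emph>\<open>Equality for \<open>U\<^bsub>n,r,k\<^esub>\<close>.\<close> Every edge contains one of the \<open>p = \<lceil>(n-1)/D\<rceil>\<close> vertices
  \<open>y\<^sub>1, \<dots>, y\<^sub>p\<close>, so the other \<open>n-p\<close> vertices form an independent set. That
  no independent set is larger is seen from a matching: the \<open>p\<close> edges
  \<open>Y\<^bsub>1,1\<^esub>, \<dots>, Y\<^bsub>p-1,1\<^esub>, Y'\<^bsub>p,s+1\<^esub>\<close> are pairwise disjoint, and an independent set omits a
  vertex of each of them. They are disjoint because consecutive blocks \<open>X\<^bsub>i,1\<^esub>\<close> of \<open>r-1\<close> integers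
  start \<open>D-1 \<ge> r-1\<close> apart, and the last block \<open>[n'-r+2, n']\<close>, whose end satisfies
  \<open>n' \<ge> (p-1)(D-1) + 1\<close>, begins after the end \<open>(p-2)(D-1) + r-1\<close> of \<open>X\<^bsub>p-1,1\<^esub>\<close>; the latter
  follows from \<open>D \<ge> 2(r-1)\<close>, which is the hypothesis \<open>k \<ge> 2\<close>.
\<close>

section \<open>Independent sets, covers and matchings\<close>

lemma independence_number_le:
  assumes "finite (verts G)" "independent G J"
    and "\<And>I. independent G I \<Longrightarrow> card I \<le> m"
  shows "independence_number G \<le> m"
proof -
  have "finite {I. independent G I}"
    by (rule finite_subset[of _ "Pow (verts G)"]) (use assms(1) in \<open>auto simp: independent_def\<close>)
  then show ?thesis
    unfolding independence_number_def using assms(2,3) by (subst Max_le_iff) auto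
qed

lemma card_le_independence_number:
  assumes "finite (verts G)" "independent G I"
  shows "card I \<le> independence_number G"
proof -
  have "finite {I. independent G I}"
    by (rule finite_subset[of _ "Pow (verts G)"]) (use assms(1) in \<open>auto simp: independent_def\<close>)
  then show ?thesis
    unfolding independence_number_def using assms(2) by (intro Max_ge) auto
qed

lemma card_edges_le_cover:
  assumes G: "finite (verts G)" and C: "C \<subseteq> verts G"
    and cover: "\<And>e. e \<in> edges G \<Longrightarrow> e \<inter> C \<noteq> {}"
  shows "card (edges G) \<le> card C * max_degree G"
proof -
  have "edges G = (\<Union>v\<in>C. {e \<in> edges G. v \<in> e})"
    using cover by blast
  also have "card \<dots> \<le> (\<Sum>v\<in>C. hdegree G v)"
    unfolding hdegree_def by (rule card_UN_le) (use G C finite_subset in auto)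
  also have "\<dots> \<le> (\<Sum>v\<in>C. max_degree G)"
    using G C by (intro sum_mono card_star_le_max_degree) auto
  finally show ?thesis by simp
qed

text \<open>An independent set omits a vertex of every edge, and the vertices omitted from disjoint edges
  are distinct.\<close>

lemma card_independent_matching:
  assumes fin: "finite (verts G)" and I: "independent G I"
    and edge: "\<And>i. i \<in> A \<Longrightarrow> Z i \<in> edges G"
    and sub: "\<And>i. i \<in> A \<Longrightarrow> Z i \<subseteq> verts G"
    and disj: "disjoint_family_on Z A"
  shows "card I + card A \<le> card (verts G)"
proof -
  have "\<forall>i\<in>A. \<exists>z. z \<in> Z i - I"
    using I edge unfolding independent_def by blast
  then obtain z where z: "\<And>i. i \<in> A \<Longrightarrow> z i \<in> Z i - I"
    by metis
  have "inj_on z A"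
  proof (rule inj_onI)
    fix i j assume ij: "i \<in> A" "j \<in> A" "z i = z j"
    then have "z i \<in> Z i \<inter> Z j" using z[of i] z[of j] by auto
    then show "i = j" using disj ij unfolding disjoint_family_on_def by blast
  qed
  moreover have "z ` A \<subseteq> verts G - I" using z sub by blast
  ultimately have "card A \<le> card (verts G - I)"
    using fin by (intro card_inj_on_le) auto
  moreover have "I \<subseteq> verts G" using I by (simp add: independent_def)
  ultimately show ?thesis
    using card_mono[OF fin, of I] card_Diff_subset[of I "verts G"] finite_subset[OF _ fin, of I]
    by auto
qed

section \<open>The upper bound for connected hypergraphs\<close>

text \<open>Along a path out of \<open>W\<close>, the first edge that is not inside \<open>W\<close> still meets \<open>W\<close>.\<close>

lemma hpath_leaves:
  assumes path: "hpath G v w es" and v: "v \<in> W" and w: "w \<notin> W"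
  obtains e where "e \<in> edges G" "e \<inter> W \<noteq> {}" "\<not> e \<subseteq> W"
proof (rule ccontr)
  assume "\<not> thesis"
  then have closed: "\<And>e. e \<in> edges G \<Longrightarrow> e \<inter> W \<noteq> {} \<Longrightarrow> e \<subseteq> W"
    using that by blast
  have es: "es \<noteq> []" "set es \<subseteq> edges G" "v \<in> hd es" "w \<in> last es"
    and meet: "\<And>i. Suc i < length es \<Longrightarrow> es ! i \<inter> es ! Suc i \<noteq> {}"
    using path unfolding hpath_def by auto
  have "es ! i \<subseteq> W" if "i < length es" for i
    using that
  proof (induction i)
    case 0
    then have "es ! 0 \<in> edges G" "v \<in> es ! 0" using es by (auto simp: hd_conv_nth)
    then show ?case using closed v by blast
  next
    case (Suc i)
    then have "es ! i \<subseteq> W" "es ! Suc i \<in> edges G" using es(2) by auto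
    then show ?case using closed meet[OF Suc.prems] by blast
  qed
  then have "last es \<subseteq> W" using es(1) by (simp add: last_conv_nth)
  then show False using es(4) w by blast
qed

text \<open>Let \<open>F\<close> be a largest set of edges such that \<open>v\<close> and the vertices of \<open>F\<close> number at most
  \<open>1 + (r-1)|F|\<close>. If some vertex were not reached, a path to it would supply an edge that adds at
  most \<open>r-1\<close> vertices, contradicting the choice of \<open>F\<close>.\<close>

lemma connected_card_verts_le:
  assumes G: "r_graph r G" and conn: "hconnected G" and v: "v \<in> verts G"
  shows "card (verts G) \<le> 1 + (r - 1) * card (edges G)"
proof -
  have finV: "finite (verts G)" and sub: "\<And>e. e \<in> edges G \<Longrightarrow> e \<subseteq> verts G \<and> finite e \<and> card e = r"
    using G by (auto simp: r_graph_def nsets_def)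
  have finE: "finite (edges G)"
    by (rule finite_subset[of _ "Pow (verts G)"]) (use finV sub in auto)
  define W where "W = (\<lambda>F. insert v (\<Union>F))"
  define good where "good = (\<lambda>F. F \<subseteq> edges G \<and> card (W F) \<le> 1 + (r - 1) * card F)"
  have "good {}" by (simp add: good_def W_def)
  moreover have "\<forall>F. good F \<longrightarrow> card F < Suc (card (edges G))"
    using finE by (auto simp: good_def less_Suc_eq_le intro: card_mono)
  ultimately have "\<exists>F. good F \<and> (\<forall>F'. good F' \<longrightarrow> card F' \<le> card F)"
    by (rule ex_has_greatest_nat)
  then obtain F where F: "good F" and maxF: "\<And>F'. good F' \<Longrightarrow> card F' \<le> card F"
    by blast
  have FE: "F \<subseteq> edges G" using F by (simp add: good_def)
  have finF: "finite F" using FE finE finite_subset by blast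
  have WV: "W F \<subseteq> verts G" using FE sub v unfolding W_def by blast
  have "W F = verts G"
  proof (rule ccontr)
    assume "W F \<noteq> verts G"
    then obtain w where w: "w \<in> verts G" "w \<notin> W F" using WV by blast
    have vW: "v \<in> W F" by (simp add: W_def)
    then obtain es where "hpath G v w es"
      using conn v w unfolding hconnected_def by metis
    then obtain e where e: "e \<in> edges G" "e \<inter> W F \<noteq> {}" "\<not> e \<subseteq> W F"
      using hpath_leaves vW w(2) by metis
    have eF: "e \<notin> F" using e(3) unfolding W_def by blast
    have WI: "W (insert e F) = W F \<union> (e - W F)" unfolding W_def by blast
    have "card (e - W F) < card e"
      using sub[OF e(1)] e(2) by (intro psubset_card_mono) auto
    then have "card (e - W F) \<le> r - 1" using sub[OF e(1)] by simp
    then have "card (W (insert e F)) \<le> card (W F) + (r - 1)"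
      unfolding WI using card_Un_le[of "W F" "e - W F"] by linarith
    also have "\<dots> \<le> 1 + (r - 1) * card (insert e F)"
      using F eF finF by (simp add: good_def)
    finally have "good (insert e F)" using FE e(1) by (simp add: good_def)
    then show False using maxF[of "insert e F"] eF finF by simp
  qed
  then have "card (verts G) \<le> 1 + (r - 1) * card F" using F by (simp add: good_def)
  also have "\<dots> \<le> 1 + (r - 1) * card (edges G)"
    using card_mono[OF finE FE] by simp
  finally show ?thesis .
qed

text \<open>The complement of \<open>I\<close> covers all edges, which bounds their number from above; connectedness
  bounds it from below.\<close>

lemma connected_cover_bound:
  assumes G: "r_graph r G" and conn: "hconnected G" and I: "independent G I"
  shows "card (verts G) - 1 \<le> (card (verts G) - card I) * (max_degree G * (r - 1))"
proof (cases "verts G = {}")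
  case True
  then show ?thesis by simp
next
  case False
  then obtain v where v: "v \<in> verts G" by blast
  have finV: "finite (verts G)" using G by (simp add: r_graph_def)
  have IV: "I \<subseteq> verts G" using I by (simp add: independent_def)
  have "e \<inter> (verts G - I) \<noteq> {}" if "e \<in> edges G" for e
    using G I that unfolding r_graph_def nsets_def independent_def by blast
  then have "card (edges G) \<le> card (verts G - I) * max_degree G"
    by (intro card_edges_le_cover finV) auto
  also have "card (verts G - I) = card (verts G) - card I"
    using IV finV finite_subset by (intro card_Diff_subset) auto
  finally have "(r - 1) * card (edges G) \<le> (r - 1) * ((card (verts G) - card I) * max_degree G)"
    by (rule mult_le_mono2)
  also have "\<dots> = (card (verts G) - card I) * (max_degree G * (r - 1))"
    by (simp only: ac_simps)
  finally show ?thesis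
    using connected_card_verts_le[OF G conn v] by linarith
qed

section \<open>The extremal graph\<close>

text \<open>All that is used of \<open>p\<close> is that it is the least \<open>c\<close> with \<open>n-1 \<le> cD\<close>.\<close>

lemma U_p_le_iff:
  assumes "k * (r - 1) > 0"
  shows "U_p n r k \<le> c \<longleftrightarrow> n - 1 \<le> c * (k * (r - 1))"
proof -
  have D: "real (k * (r - 1)) > 0" using assms by (simp only: of_nat_0_less_iff)
  have "U_p n r k \<le> c \<longleftrightarrow> real (n - 1) / real (k * (r - 1)) \<le> real c"
    unfolding U_p_def by (simp only: nat_le_iff ceiling_le_iff of_int_of_nat_eq)
  also have "\<dots> \<longleftrightarrow> real (n - 1) \<le> real (c * (k * (r - 1)))"
    using D by (simp only: pos_divide_le_eq of_nat_mult)
  finally show ?thesis by (simp only: of_nat_le_iff)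
qed

lemma ceiling_eq_U_p:
  assumes "r \<ge> 1" "n \<ge> 1"
  shows "\<lceil>(real n - 1) / (real k * (real r - 1))\<rceil> = int (U_p n r k)"
proof -
  have "(real n - 1) / (real k * (real r - 1)) = real (n - 1) / real (k * (r - 1))"
    using assms by (simp add: of_nat_diff)
  moreover have "0 \<le> \<lceil>real (n - 1) / real (k * (r - 1))\<rceil>"
    using ceiling_mono[of 0 "real (n - 1) / real (k * (r - 1))"]
    by (simp only: ceiling_zero) (simp only: zero_le_divide_iff of_nat_0_le_iff simp_thms)
  ultimately show ?thesis unfolding U_p_def by simp
qed

lemma minus_ceiling_eq_floor:
  fixes n :: int and D :: real
  assumes "D \<noteq> 0"
  shows "n - \<lceil>(n - 1) / D\<rceil> = \<lfloor>((D - 1) * n + 1) / D\<rfloor>"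
proof -
  have "((D - 1) * n + 1) / D = of_int n + - ((n - 1) / D)"
    using assms by (simp add: field_simps)
  then have "\<lfloor>((D - 1) * n + 1) / D\<rfloor> = n + \<lfloor>- ((n - 1) / D)\<rfloor>"
    by (metis int_add_floor)
  then show ?thesis
    by (simp add: ceiling_def)
qed

text \<open>The last bound is \<open>n' = (p-1)(D-1) + q\<close> with \<open>q \<ge> 1\<close>: minimality of \<open>p\<close> gives
  \<open>n-1 > (p-1)D\<close>, and subtracting \<open>p-1\<close> on both sides replaces \<open>D\<close> by \<open>D-1\<close>.\<close>

lemma U_p_bounds:
  assumes r: "r \<ge> 2" and k: "k \<ge> 1" and n: "n \<ge> 2"
  shows "1 \<le> U_p n r k" and "U_p n r k < n"
    and "(U_p n r k - 1) * (k * (r - 1) - 1) + 1 \<le> U_n' n r k"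
proof -
  let ?p = "U_p n r k" and ?D = "k * (r - 1)"
  have D: "?D > 0" using r k by simp
  have "\<not> ?p \<le> 0" unfolding U_p_le_iff[OF D] mult_0 using n by linarith
  then show p: "1 \<le> ?p" by simp
  have "n - 1 \<le> (n - 1) * ?D" using mult_le_mono2[of 1 ?D "n - 1"] D by linarith
  then have "?p \<le> n - 1" by (simp only: U_p_le_iff[OF D])
  then show pn: "?p < n" using n by simp
  have D1: "?D - 1 + 1 = ?D" using D by linarith
  have "\<not> ?p \<le> ?p - 1" using p by simp
  then have "(?p - 1) * ?D < n - 1" unfolding U_p_le_iff[OF D] by simp
  moreover have "(?p - 1) * ?D = (?p - 1) * (?D - 1) + (?p - 1)"
    using add_mult_distrib2[of "?p - 1" "?D - 1" 1] D1 by (simp only: mult_1_right)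
  ultimately show "(?p - 1) * (?D - 1) + 1 \<le> U_n' n r k"
    unfolding U_n'_def using p pn by linarith
qed

lemma U_X_first: "U_X r k i 1 = {(i - 1) * (k * (r - 1) - 1) + 1..(i - 1) * (k * (r - 1) - 1) + (r - 1)}"
proof -
  have "U_X r k i 1 = (\<lambda>h. (i - 1) * (k * (r - 1) - 1) + h) ` {1..r - 1}"
    unfolding U_X_def U_x_def image_def by (rule Collect_cong) auto
  then show ?thesis by (simp only: image_add_atLeastAtMost) (simp only: add.commute)
qed

lemma is_U_verts_edges:
  assumes "is_U n r k G"
  shows "verts G = {1..n}" and "U_M n r k \<subseteq> edges G"
  using assms by (auto simp: is_U_def U_choice_def split: if_splits)

text \<open>This makes \<open>[n']\<close> independent. The edges in \<open>U_M\<close> contain some \<open>y\<^sub>i > n'\<close>. When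
  \<open>n \<le> k(r-1)+1\<close> there may be other edges, but all of them contain \<open>n > n'\<close>.\<close>

lemma is_U_edge_meets_top:
  assumes G: "is_U n r k G" and r: "r \<ge> 2" and k: "k \<ge> 1" and n: "n \<ge> 2" and e: "e \<in> edges G"
  shows "\<not> e \<subseteq> {1..U_n' n r k}"
proof (cases "n > k * (r - 1) + 1")
  case True
  have p: "1 \<le> U_p n r k" using U_p_bounds r k n by blast
  have "e \<in> U_M n r k" using G True e by (simp add: is_U_def)
  then have "\<exists>i\<ge>1. U_y n r k i \<in> e"
    using p by (auto simp: U_M_def U_Y_def U_Y'_def)
  then show ?thesis by (fastforce simp: U_y_def)
next
  case False
  then have "n \<in> e" using G e by (auto simp: is_U_def U_choice_def)
  moreover have "U_n' n r k < n"
    using U_p_bounds[OF r k n] unfolding U_n'_def by linarith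
  ultimately show ?thesis by auto
qed

text \<open>The \<open>X\<close>-parts of the disjoint edges in \<open>U\<^bsub>n,r,k\<^esub>\<close>.\<close>

definition U_block :: "nat \<Rightarrow> nat \<Rightarrow> nat \<Rightarrow> nat \<Rightarrow> nat set" where
  "U_block n r k i = (if i < U_p n r k then U_X r k i 1 else U_X' n r k)"

lemma U_block_edge:
  assumes "k \<ge> 1" "1 \<le> i" "i \<le> U_p n r k"
  shows "U_block n r k i \<union> {U_y n r k i} \<in> U_M n r k"
proof (cases "i < U_p n r k")
  case True
  then have "U_Y n r k i 1 \<in> U_M n r k"
    using assms unfolding U_M_def by (intro UnI1 CollectI exI[of _ i] exI[of _ 1]) auto
  then show ?thesis using True by (simp add: U_block_def U_Y_def)
next
  case False
  then have "i = U_p n r k" using assms by simp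
  then show ?thesis by (simp add: U_block_def U_M_def U_Y'_def)
qed

text \<open>The hypothesis \<open>r \<le> n\<close> matters when \<open>p = 1\<close>: there it keeps the single block
  \<open>[n'-r+2, n']\<close> above \<open>0\<close>.\<close>

lemma U_block_subset:
  assumes r: "r \<ge> 2" and k: "k \<ge> 2" and n: "n \<ge> r" and i: "1 \<le> i" "i \<le> U_p n r k"
  shows "U_block n r k i \<subseteq> {1..U_n' n r k}"
proof -
  let ?p = "U_p n r k" and ?d = "k * (r - 1) - 1"
  have d: "r - 1 \<le> ?d"
  proof -
    have "2 * (r - 1) \<le> k * (r - 1)" using k by (rule mult_le_mono1)
    then show ?thesis using r by linarith
  qed
  have n': "(?p - 1) * ?d + 1 \<le> U_n' n r k"
    using U_p_bounds(3)[of r k n] r k n by simp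
  show ?thesis
  proof (cases "i < ?p")
    case True
    then have "i * ?d \<le> (?p - 1) * ?d" by (intro mult_le_mono1) simp
    moreover have "i * ?d = (i - 1) * ?d + ?d" using i by (cases i) auto
    ultimately have "(i - 1) * ?d + (r - 1) \<le> U_n' n r k" using n' d by linarith
    then show ?thesis using True by (auto simp: U_block_def U_X_first simp del: One_nat_def)
  next
    case False
    have "r - 1 \<le> U_n' n r k"
    proof (cases "?p = 1")
      case True
      then show ?thesis using n by (simp add: U_n'_def)
    next
      case False
      then have "1 * ?d \<le> (?p - 1) * ?d"
        using U_p_bounds(1)[of r k n] r k n by (intro mult_le_mono1) linarith
      then show ?thesis using n' d by linarith
    qed
    then show ?thesis using False r by (auto simp: U_block_def U_X'_def)
  qed
qed

text \<open>The tight case is the step from \<open>X\<^bsub>p-1,1\<^esub>\<close> to the last block. There are at least \<open>D\<close> integers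
  from the start \<open>(p-2)(D-1) + 1\<close> of the former to the end \<open>n' \<ge> (p-1)(D-1) + 1\<close> of the latter,
  and two disjoint blocks of \<open>r-1\<close> integers fit there because \<open>D \<ge> 2(r-1)\<close>.\<close>

lemma U_block_less:
  assumes r: "r \<ge> 2" and k: "k \<ge> 2" and n: "n \<ge> 2"
    and ij: "1 \<le> i" "i < j" "j \<le> U_p n r k"
    and x: "x \<in> U_block n r k i" and y: "y \<in> U_block n r k j"
  shows "x < y"
proof -
  let ?p = "U_p n r k" and ?d = "k * (r - 1) - 1"
  have d: "2 * (r - 1) \<le> ?d + 1"
  proof -
    have "2 * (r - 1) \<le> k * (r - 1)" using k by (rule mult_le_mono1)
    then show ?thesis using r by linarith
  qed
  have "x \<le> (i - 1) * ?d + (r - 1)"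
    using x ij by (simp add: U_block_def U_X_first del: One_nat_def)
  moreover have "i * ?d = (i - 1) * ?d + ?d" using ij(1) by (cases i) auto
  moreover have "i * ?d \<le> (j - 1) * ?d" using ij by (intro mult_le_mono1) simp
  ultimately have xj: "x + ?d \<le> (j - 1) * ?d + (r - 1)" by linarith
  show ?thesis
  proof (cases "j < ?p")
    case True
    then have "(j - 1) * ?d + 1 \<le> y"
      using y by (simp add: U_block_def U_X_first del: One_nat_def)
    then show ?thesis using xj d r by linarith
  next
    case False
    then have jp: "j = ?p" using ij by simp
    have "U_n' n r k + 2 - r \<le> y"
      using y jp by (simp add: U_block_def U_X'_def)
    moreover have "(j - 1) * ?d + 1 \<le> U_n' n r k"
      using U_p_bounds(3)[of r k n] r k n jp by simp
    ultimately show ?thesis using xj d r by linarith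
  qed
qed

lemma U_blocks_disjoint:
  assumes r: "r \<ge> 2" and k: "k \<ge> 2" and n: "n \<ge> r"
  shows "disjoint_family_on (\<lambda>i. U_block n r k i \<union> {U_y n r k i}) {1..U_p n r k}"
proof -
  have less: "(U_block n r k i \<union> {U_y n r k i}) \<inter> (U_block n r k j \<union> {U_y n r k j}) = {}"
    if ij: "1 \<le> i" "i < j" "j \<le> U_p n r k" for i j
  proof -
    have "U_block n r k i \<inter> U_block n r k j = {}"
      using U_block_less[OF r k _ ij] n r by fastforce
    moreover have "U_block n r k i \<subseteq> {1..U_n' n r k}" "U_block n r k j \<subseteq> {1..U_n' n r k}"
      using U_block_subset[OF r k n] ij by simp_all
    ultimately show ?thesis
      using ij by (fastforce simp: U_y_def)
  qed
  show ?thesis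
    unfolding disjoint_family_on_def
  proof (intro ballI impI)
    fix i j assume "i \<in> {1..U_p n r k}" "j \<in> {1..U_p n r k}" "i \<noteq> j"
    then show "(U_block n r k i \<union> {U_y n r k i}) \<inter> (U_block n r k j \<union> {U_y n r k j}) = {}"
      using less[of i j] less[of j i] by (cases i j rule: linorder_cases) auto
  qed
qed

lemma independence_number_U:
  assumes G: "is_U n r k G" and r: "r \<ge> 2" and k: "k \<ge> 2" and n: "n \<ge> r"
  shows "independence_number G = n - U_p n r k"
proof (rule antisym)
  note VE = is_U_verts_edges[OF G]
  have k1: "k \<ge> 1" and n2: "n \<ge> 2" using r k n by simp_all
  have fin: "finite (verts G)" by (simp add: VE)
  have n': "U_n' n r k + U_p n r k = n"
    using U_p_bounds(2)[OF r k1 n2] by (simp add: U_n'_def)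
  have ind: "independent G {1..U_n' n r k}"
    unfolding independent_def VE(1) using is_U_edge_meets_top[OF G r k1 n2] n' by auto
  then show "n - U_p n r k \<le> independence_number G"
    using card_le_independence_number[OF fin ind] by (simp add: U_n'_def)
  show "independence_number G \<le> n - U_p n r k"
  proof (rule independence_number_le[OF fin ind])
    fix I assume I: "independent G I"
    have "card I + card {1..U_p n r k} \<le> card (verts G)"
    proof (rule card_independent_matching[OF fin I])
      fix i assume i: "i \<in> {1..U_p n r k}"
      show "U_block n r k i \<union> {U_y n r k i} \<in> edges G"
        using U_block_edge[of k i n r] i k VE(2) by auto
      show "U_block n r k i \<union> {U_y n r k i} \<subseteq> verts G"
        using U_block_subset[OF r k n, of i] i n' by (fastforce simp: VE(1) U_y_def)
    qed (rule U_blocks_disjoint[OF r k n])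
    then show "card I \<le> n - U_p n r k" by (simp add: VE(1))
  qed
qed

section \<open>The sharp bound\<close>

theorem theorem2p2:
  fixes r k n :: nat
  assumes "r \<ge> 2" and "k \<ge> 2" and "n \<ge> min_order r k"
  shows "(\<forall>G :: 'a hypergraph.
            r_graph r G \<and> hconnected G \<and> card (verts G) = n \<and> max_degree G = k \<longrightarrow>
            int (independence_number G) \<le> int n - \<lceil>(real n - 1) / (real k * (real r - 1))\<rceil>) \<and>
         int n - \<lceil>(real n - 1) / (real k * (real r - 1))\<rceil>
           = \<lfloor>((real k * (real r - 1) - 1) * real n + 1) / (real k * (real r - 1))\<rfloor> \<and>
         (\<forall>U. is_U n r k U \<longrightarrow>
            int (independence_number U) = int n - \<lceil>(real n - 1) / (real k * (real r - 1))\<rceil>)"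
proof -
  have rn: "r \<le> n" using min_order_star[of r k n] assms by simp
  have D: "k * (r - 1) > 0" using assms by simp
  have pn: "U_p n r k < n" using U_p_bounds(2)[of r k n] assms rn by simp
  have ceil: "\<lceil>(real n - 1) / (real k * (real r - 1))\<rceil> = int (U_p n r k)"
    using ceiling_eq_U_p[of r n k] assms rn by simp
  have "independence_number G \<le> n - U_p n r k"
    if G: "r_graph r G" "hconnected G" "card (verts G) = n" "max_degree G = k"
    for G :: "'a hypergraph"
  proof (rule independence_number_le)
    show fin: "finite (verts G)" using G(1) by (simp add: r_graph_def)
    show "independent G {}"
      using G(1) assms(1) by (auto simp: independent_def r_graph_def nsets_def)
    fix I assume I: "independent G I"
    have "n - 1 \<le> (n - card I) * (k * (r - 1))"
      using connected_cover_bound[OF G(1,2) I] G(3,4) by simp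
    then have "U_p n r k \<le> n - card I" by (simp only: U_p_le_iff[OF D])
    moreover have "card I \<le> n"
      using I card_mono[OF fin, of I] G(3) by (simp add: independent_def)
    ultimately show "card I \<le> n - U_p n r k" by linarith
  qed
  then have upper: "int (independence_number G) \<le> int n - int (U_p n r k)"
    if "r_graph r G \<and> hconnected G \<and> card (verts G) = n \<and> max_degree G = k"
    for G :: "'a hypergraph"
    using that pn by fastforce
  have "int n - \<lceil>(real n - 1) / (real k * (real r - 1))\<rceil>
      = \<lfloor>((real k * (real r - 1) - 1) * real n + 1) / (real k * (real r - 1))\<rfloor>"
    using minus_ceiling_eq_floor[of "real k * (real r - 1)" "int n"] assms by simp
  moreover have "int (independence_number U) = int n - int (U_p n r k)" if "is_U n r k U" for U
    using independence_number_U[OF that assms(1,2) rn] pn by simp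
  ultimately show ?thesis
    using upper by (simp only: ceil) blast
qed

end
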